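(* Let $k\ge 1$ and let $G$ be a graph with minimum degree at least $k$, with $n$ vertices and $m$ edges. Then $$\gamma_{\times k,t}^{r}(G)\ge \frac{3n}{2}-\frac{m}{k}.$$
   Context: All graphs are finite and simple; $N(x)$ denotes the open neighborhood of $x$. For an integer $k\ge 1$, a set $S\subseteq V(G)$ is a $k$-tuple total dominating set of $G$ if $|N(x)\cap S|\ge k$ for every $x\in V(G)$. It is a $k$-tuple total restrained dominating set (kTRDS) if moreover every vertex $x\in V(G)\setminus S$ is adjacent to at least $k$ vertices of $V(G)\setminus S$. For a graph with minimum degree at least $k$, $\gamma_{\times k,t}^{r}(G)$ denotes the minimum cardinality of a kTRDS of $G$. *)

theory Defs
  imports Complex_Main
begin

locale finite_simple_graph =
  fixes V :: "'a set" and E :: "'a set set"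
  assumes finite_vertices: "finite V"
    and edges: "e \<in> E \<Longrightarrow> e \<subseteq> V \<and> card e = 2"

definition neighborhood :: "'a set set \<Rightarrow> 'a \<Rightarrow> 'a set" where
  "neighborhood E x = {y. {x, y} \<in> E}"

definition degree :: "'a set set \<Rightarrow> 'a \<Rightarrow> nat" where
  "degree E x = card (neighborhood E x)"

definition tuple_total_dominating :: "nat \<Rightarrow> 'a set \<Rightarrow> 'a set set \<Rightarrow> 'a set \<Rightarrow> bool" where
  "tuple_total_dominating k V E S \<longleftrightarrow>
     S \<subseteq> V \<and> (\<forall>x\<in>V. k \<le> card (neighborhood E x \<inter> S))"

definition tuple_total_restrained_dominating ::
    "nat \<Rightarrow> 'a set \<Rightarrow> 'a set set \<Rightarrow> 'a set \<Rightarrow> bool" where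
  "tuple_total_restrained_dominating k V E S \<longleftrightarrow>
     tuple_total_dominating k V E S \<and>
     (\<forall>x\<in>V - S. k \<le> card (neighborhood E x \<inter> (V - S)))"

text \<open>Meaningful when the minimum degree is at least \<open>k\<close>: by the two lemmas below,
  the minimum then exists and is attained.\<close>

definition restrained_domination_number :: "nat \<Rightarrow> 'a set \<Rightarrow> 'a set set \<Rightarrow> nat" where
  "restrained_domination_number k V E =
     (LEAST c. \<exists>S. tuple_total_restrained_dominating k V E S \<and> card S = c)"

lemma (in finite_simple_graph) vertices_tuple_total_restrained_dominating:
  assumes "\<forall>x\<in>V. k \<le> degree E x"
  shows "tuple_total_restrained_dominating k V E V"
proof -
  have "neighborhood E x \<inter> V = neighborhood E x" for x
    using edges by (auto simp: neighborhood_def)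
  with assms show ?thesis
    by (simp add: tuple_total_restrained_dominating_def tuple_total_dominating_def degree_def)
qed

lemma (in finite_simple_graph) restrained_domination_number_attained:
  assumes "\<forall>x\<in>V. k \<le> degree E x"
  shows "\<exists>S. tuple_total_restrained_dominating k V E S \<and>
           card S = restrained_domination_number k V E"
  unfolding restrained_domination_number_def
  by (rule LeastI_ex) (use vertices_tuple_total_restrained_dominating[OF assms] in blast)

end

theory Submission imports Defs begin

text \<open>Let \<open>S\<close> be a kTRDS and \<open>T = V - S\<close>. The degree sum \<open>2m\<close> splits into the adjacency counts
  \<open>S\<close>-\<open>S\<close>, \<open>S\<close>-\<open>T\<close>, \<open>T\<close>-\<open>S\<close> and \<open>T\<close>-\<open>T\<close>. The first is at least \<open>k|S|\<close>, the last two are at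
  least \<open>k|T|\<close> each, and the second equals the third. Hence \<open>2m \<ge> k|S| + 3k|T| = 3kn - 2k|S|\<close>.\<close>

text \<open>Double counting of the pairs \<open>(x, y)\<close> in \<open>A \<times> B\<close> with
  \<open>{x, y} \<in> E\<close>, a condition symmetric in \<open>x\<close> and
  \<open>y\<close>.\<close>

lemma sum_card_neighborhood_swap:
  assumes "finite A" "finite B"
  shows "(\<Sum>x\<in>A. card (neighborhood E x \<inter> B)) = (\<Sum>y\<in>B. card (neighborhood E y \<inter> A))"
proof -
  have "neighborhood E x \<inter> B = {y \<in> B. {x, y} \<in> E}"
    "neighborhood E x \<inter> A = {y \<in> A. {y, x} \<in> E}" for x
    by (auto simp: neighborhood_def insert_commute)
  then show ?thesis
    using assms by (simp add: sum_multicount_gen)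
qed

context finite_simple_graph
begin

lemma neighborhood_subset: "neighborhood E x \<subseteq> V"
  using edges by (auto simp: neighborhood_def)

lemma finite_edges: "finite E"
  by (rule finite_subset[of _ "Pow V"]) (use edges finite_vertices in auto)

text \<open>Puts the degree in the form needed for counting vertex-edge incidences.\<close>

lemma degree_eq_card_incident_edges: "degree E x = card {e \<in> E. x \<in> e}"
proof -
  have "bij_betw (\<lambda>y. {x, y}) (neighborhood E x) {e \<in> E. x \<in> e}"
  proof (rule bij_betw_imageI)
    show "inj_on (\<lambda>y. {x, y}) (neighborhood E x)"
      by (auto simp: inj_on_def doubleton_eq_iff)
    have "e \<in> (\<lambda>y. {x, y}) ` neighborhood E x" if e: "e \<in> E" "x \<in> e" for e
    proof -
      obtain y where "e = {x, y}"
        using edges[OF e(1)] e(2) by (auto simp: card_2_iff)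
      with e(1) show ?thesis by (auto simp: neighborhood_def)
    qed
    then show "(\<lambda>y. {x, y}) ` neighborhood E x = {e \<in> E. x \<in> e}"
      by (auto simp: neighborhood_def)
  qed
  then show ?thesis
    by (simp add: degree_def bij_betw_same_card)
qed

text \<open>Handshake lemma: each edge is counted once at each of its two endpoints.\<close>

lemma sum_degree: "(\<Sum>x\<in>V. degree E x) = 2 * card E"
proof -
  have "{x \<in> V. x \<in> e} = e" if "e \<in> E" for e
    using edges[OF that] by auto
  then have "(\<Sum>x\<in>V. card {e \<in> E. x \<in> e}) = 2 * card E"
    using edges by (intro sum_multicount finite_vertices finite_edges) simp
  then show ?thesis
    by (simp add: degree_eq_card_incident_edges)
qed

lemma tuple_total_restrained_dominating_card_edges:
  assumes "tuple_total_restrained_dominating k V E S"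
  shows "3 * k * card V \<le> 2 * card E + 2 * k * card S"
proof -
  define T where "T = V - S"
  \<comment> \<open>Ordered adjacent pairs are counted, so an edge inside \<open>S\<close>
    contributes 2 to \<open>d S S\<close>.\<close>
  define d where "d A B = (\<Sum>x\<in>A. card (neighborhood E x \<inter> B))" for A B
  have S: "S \<subseteq> V" and dom: "\<And>x. x \<in> V \<Longrightarrow> k \<le> card (neighborhood E x \<inter> S)"
    and res: "\<And>x. x \<in> T \<Longrightarrow> k \<le> card (neighborhood E x \<inter> T)"
    using assms
    by (auto simp: tuple_total_restrained_dominating_def tuple_total_dominating_def T_def)
  have fin: "finite S" "finite T" and V: "V = S \<union> T" "S \<inter> T = {}"
    using S finite_vertices by (auto simp: T_def intro: finite_subset)
  have "degree E x = card (neighborhood E x \<inter> S) + card (neighborhood E x \<inter> T)" for x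
  proof -
    have "neighborhood E x = neighborhood E x \<inter> S \<union> neighborhood E x \<inter> T"
      using neighborhood_subset V(1) by blast
    then show ?thesis
      unfolding degree_def using fin V(2)
      by (metis card_Un_disjoint finite_Int inf_assoc inf_bot_right inf_left_commute)
  qed
  then have "2 * card E = d S S + d S T + (d T S + d T T)"
    unfolding sum_degree[symmetric] d_def V(1)
    by (simp add: sum.union_disjoint fin V(2) sum.distrib)
  \<comment> \<open>A vertex of \<open>S\<close> may have few neighbors in \<open>T\<close>, so
    \<open>d S T\<close> is bounded from the side of \<open>T\<close>.\<close>
  moreover have "d S T = d T S"
    unfolding d_def by (rule sum_card_neighborhood_swap[OF fin])
  moreover have "card S * k \<le> d S S"
    unfolding d_def using sum_mono[of S "\<lambda>_. k"] dom S by (simp add: subset_iff)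
  \<comment> \<open>The first bound is domination, the second is the restrained condition.\<close>
  moreover have "card T * k \<le> d T S" "card T * k \<le> d T T"
    unfolding d_def using sum_mono[of T "\<lambda>_. k"] dom res T_def by simp_all
  moreover have "card V = card S + card T"
    by (simp add: V card_Un_disjoint fin)
  ultimately show ?thesis
    by (simp add: algebra_simps)
qed

end

theorem theorem3p3:
  fixes k :: nat and V :: "'a set" and E :: "'a set set"
  assumes "k \<ge> 1"
    and "finite_simple_graph V E"
    and "\<forall>x\<in>V. degree E x \<ge> k"
  shows "real (restrained_domination_number k V E)
           \<ge> 3 * real (card V) / 2 - real (card E) / real k"
proof -
  interpret finite_simple_graph V E by fact
  obtain S where "tuple_total_restrained_dominating k V E S"
    and S: "card S = restrained_domination_number k V E"
    using restrained_domination_number_attained[OF assms(3)] by blast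
  then have "3 * k * card V \<le> 2 * card E + 2 * k * card S"
    by (intro tuple_total_restrained_dominating_card_edges)
  then have "real (3 * k * card V) \<le> real (2 * card E + 2 * k * card S)"
    by (rule of_nat_mono)
  \<comment> \<open>Division by \<open>2 * k\<close>, which is positive.\<close>
  with \<open>k \<ge> 1\<close> show ?thesis
    unfolding S[symmetric] by (simp add: field_simps)
qed

end
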